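(* Let $f$ be either the function $f(x)=e^{\lambda x}-1$ for some positive real number $\lambda$, or the function $f(x)=x^\beta$, $x\geq 0$, for some real number $\beta>2$. Then $\Sigma_f$ is uniquely maximized by the quasi-star graph $QS(n,m)$ over $\mathbb{G}(n,m)$ for any two integers $m$ and $n$ such that $0\le m\le n-1$.
   Context: Graphs are finite and simple, with vertex set $\{1,\dots,n\}$; $\mathbb{G}(n,m)$ is the set of graphs with $n$ vertices and $m$ edges. For a graph with degree sequence $d=(d_1,\dots,d_n)$, $\Sigma_f(d)=\sum_{i=1}^n f(d_i)$. $\Sigma_f$ is uniquely maximized by $G\in\mathbb{G}(n,m)$ over $\mathbb{G}(n,m)$ if the degree sequence of $G$ attains the maximum of $\Sigma_f$ among all degree sequences of graphs in $\mathbb{G}(n,m)$ and, up to isomorphism, $G$ is the only graph in $\mathbb{G}(n,m)$ whose degree sequence does so. For $m\le n-1$, $QS(n,m)$ is isomorphic to the star $K_{1,m}$ together with $n-m-1$ isolated vertices. *)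

theory Defs
  imports Complex_Main
begin

text \<open>A simple graph on the vertex set \<open>{1..n}\<close> is represented by its edge set, a set of
  two-element subsets of \<open>{1..n}\<close>; as isolated vertices are not visible in the edge set,
  \<open>n\<close> is passed along explicitly wherever it matters.\<close>

definition graphs :: "nat \<Rightarrow> nat \<Rightarrow> nat set set set" where
  "graphs n m = {G. G \<subseteq> {e. e \<subseteq> {1..n} \<and> card e = 2} \<and> card G = m}"

definition degree :: "nat set set \<Rightarrow> nat \<Rightarrow> nat" where
  "degree G v = card {e \<in> G. v \<in> e}"

definition degree_sequence :: "nat \<Rightarrow> nat set set \<Rightarrow> nat list" where
  "degree_sequence n G = map (degree G) [1..<Suc n]"

definition Sigma_f :: "(real \<Rightarrow> real) \<Rightarrow> nat list \<Rightarrow> real" where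
  "Sigma_f f d = (\<Sum>i<length d. f (real (d ! i)))"

definition isomorphic :: "nat \<Rightarrow> nat set set \<Rightarrow> nat set set \<Rightarrow> bool" where
  "isomorphic n G H \<longleftrightarrow>
     (\<exists>\<phi>. bij_betw \<phi> {1..n} {1..n} \<and>
          (\<forall>u\<in>{1..n}. \<forall>v\<in>{1..n}. {u, v} \<in> G \<longleftrightarrow> {\<phi> u, \<phi> v} \<in> H))"

definition uniquely_maximized_by ::
    "(real \<Rightarrow> real) \<Rightarrow> nat \<Rightarrow> nat \<Rightarrow> nat set set \<Rightarrow> bool" where
  "uniquely_maximized_by f n m G \<longleftrightarrow>
     G \<in> graphs n m \<and>
     (\<forall>H\<in>graphs n m. Sigma_f f (degree_sequence n H) \<le> Sigma_f f (degree_sequence n G)) \<and>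
     (\<forall>H\<in>graphs n m. Sigma_f f (degree_sequence n H) = Sigma_f f (degree_sequence n G)
        \<longrightarrow> isomorphic n H G)"

text \<open>The quasi-star graph in the range \<open>m < n\<close>, where it is the star \<open>K\<^bsub>1,m\<^esub>\<close> (with centre
  \<open>1\<close> and leaves \<open>2, \<dots>, m + 1\<close>) together with the \<open>n - m - 1\<close> isolated vertices
  \<open>m + 2, \<dots>, n\<close>. The edge set then does not depend on \<open>n\<close>. Outside this range the
  definition is not meaningful.\<close>

definition quasi_star :: "nat \<Rightarrow> nat \<Rightarrow> nat set set" where
  "quasi_star n m = {{1, v} | v. v \<in> {2..m + 1}}"

end

(* Write f x = x g x. Each edge uv contributes g (deg u) + g (deg v) to the sum of f over the
   degrees, and deg u + deg v \<le> m + 1. For the given f, the function g is strictly increasing and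
   strictly convex, so this contribution is at most g 1 + g m, with equality only if one end has
   degree m, that is, only if the graph is a star. For f x = x^2 the function g is linear and
   uniqueness fails (triangle against K_{1,3}). *)
theory Submission
  imports Defs
begin

section \<open>Degree sums over edges\<close>

lemma graphsD:
  assumes "H \<in> graphs n m"
  shows "finite H" "card H = m" "\<And>e. e \<in> H \<Longrightarrow> e \<subseteq> {1..n} \<and> card e = 2"
proof -
  show "\<And>e. e \<in> H \<Longrightarrow> e \<subseteq> {1..n} \<and> card e = 2" "card H = m"
    using assms by (auto simp: graphs_def)
  have "H \<subseteq> Pow {1..n}" using assms by (auto simp: graphs_def)
  then show "finite H" by (rule finite_subset) simp
qed

lemma Sigma_f_degree_sequence:
  "Sigma_f f (degree_sequence n H) = (\<Sum>v\<in>{1..n}. f (real (degree H v)))"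
proof -
  have "Sigma_f f (degree_sequence n H) = (\<Sum>i<n. f (real (degree H (Suc i))))"
    unfolding Sigma_f_def degree_sequence_def
    by (intro sum.cong) (auto simp del: upt_Suc)
  also have "\<dots> = (\<Sum>v\<in>{1..n}. f (real (degree H v)))"
    by (rule sum.reindex_bij_witness[where j = Suc and i = "\<lambda>v. v - 1"]) auto
  finally show ?thesis .
qed

text \<open>Double counting of incident pairs: the factor \<open>real k\<close> in \<open>fg\<close>
  is the number of edges at a vertex of degree \<open>k\<close>. At \<open>k = 0\<close> it gives
  \<open>f 0 = 0\<close>, so isolated vertices contribute nothing.\<close>

lemma Sigma_f_eq_sum_edges:
  assumes H: "H \<in> graphs n m" and fg: "\<And>k :: nat. f (real k) = real k * g (real k)"
  shows "Sigma_f f (degree_sequence n H) = (\<Sum>e\<in>H. \<Sum>v\<in>e. g (real (degree H v)))"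
proof -
  note [simp] = graphsD(1)[OF H]
  have "Sigma_f f (degree_sequence n H)
      = (\<Sum>v\<in>{1..n}. \<Sum>e\<in>{e\<in>H. v \<in> e}. g (real (degree H v)))"
    unfolding Sigma_f_degree_sequence fg by (simp add: degree_def)
  also have "\<dots> = (\<Sum>e\<in>H. \<Sum>v\<in>{v\<in>{1..n}. v \<in> e}. g (real (degree H v)))"
    by (rule sum.swap_restrict) auto
  also have "\<dots> = (\<Sum>e\<in>H. \<Sum>v\<in>e. g (real (degree H v)))"
    by (intro sum.cong refl) (use graphsD(3)[OF H] in blast)
  finally show ?thesis .
qed

lemma degree_pos:
  assumes "finite H" "e \<in> H" "v \<in> e"
  shows "1 \<le> degree H v"
proof -
  have "card {e\<in>H. v \<in> e} \<noteq> 0" using assms by auto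
  then show ?thesis by (simp add: degree_def)
qed

text \<open>Inclusion-exclusion: the edge \<open>{u, v}\<close> is the only one counted in both
  degrees.\<close>

lemma degree_add_le:
  assumes fin: "finite H" and two: "\<And>e. e \<in> H \<Longrightarrow> card e = 2" and uv: "{u, v} \<in> H"
  shows "degree H u + degree H v \<le> card H + 1"
proof -
  have "u \<noteq> v" using two[OF uv] by (cases "u = v") auto
  have "e = {u, v}" if "e \<in> H" "u \<in> e" "v \<in> e" for e
    using two[OF that(1)] that(2,3) \<open>u \<noteq> v\<close> by (auto simp: card_2_iff)
  then have "{e\<in>H. u \<in> e} \<inter> {e\<in>H. v \<in> e} \<subseteq> {{u, v}}" by auto
  from card_mono[OF _ this] have "card ({e\<in>H. u \<in> e} \<inter> {e\<in>H. v \<in> e}) \<le> 1"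
    by simp
  moreover have "card ({e\<in>H. u \<in> e} \<union> {e\<in>H. v \<in> e}) \<le> card H"
    using fin by (intro card_mono) auto
  ultimately show ?thesis
    using card_Un_Int[of "{e\<in>H. u \<in> e}" "{e\<in>H. v \<in> e}"] fin by (simp add: degree_def)
qed

lemma degree_eq_card_iff:
  assumes "finite H"
  shows "degree H u = card H \<longleftrightarrow> (\<forall>e\<in>H. u \<in> e)"
proof
  assume "degree H u = card H"
  then have "{e\<in>H. u \<in> e} = H"
    using assms by (intro card_subset_eq) (auto simp: degree_def)
  then show "\<forall>e\<in>H. u \<in> e" by blast
next
  assume "\<forall>e\<in>H. u \<in> e"
  then have "{e\<in>H. u \<in> e} = H" by blast
  then show "degree H u = card H" by (simp add: degree_def)
qed

text \<open>By \<open>degree_add_le\<close>, a neighbour of a vertex of degree \<open>m\<close> has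
  degree exactly 1. This evaluates the sum for the star and settles the equality case of the edge
  bound.\<close>

lemma edge_weight_full_degree:
  fixes g :: "real \<Rightarrow> real"
  assumes H: "H \<in> graphs n m" and e: "e \<in> H" "u \<in> e" "degree H u = m"
  shows "(\<Sum>v\<in>e. g (real (degree H v))) = g 1 + g (real m)"
proof -
  obtain v where v: "e = {u, v}" "u \<noteq> v"
    using graphsD(3)[OF H e(1)] e(2) by (auto simp: card_2_iff)
  have "1 \<le> degree H v" using degree_pos[OF graphsD(1)[OF H] e(1), of v] v by simp
  moreover have "degree H u + degree H v \<le> m + 1"
    using degree_add_le[of H u v] graphsD[OF H] e v by auto
  ultimately have "degree H v = 1" using e(3) by simp
  then show ?thesis using v e(3) by simp
qed

section \<open>Stars\<close>

lemma quasi_star_in_graphs: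
  assumes "m < n"
  shows "quasi_star n m \<in> graphs n m"
proof -
  have eq: "quasi_star n m = (\<lambda>v. {1, v}) ` {2..m + 1}"
    by (auto simp: quasi_star_def)
  have "inj_on (\<lambda>v. {1, v}) {2..m + 1}"
    by (auto simp: inj_on_def doubleton_eq_iff)
  then have "card (quasi_star n m) = m" by (simp add: eq card_image)
  then show ?thesis using assms by (auto simp: graphs_def eq)
qed

text \<open>Three bijections are glued: centre to centre, leaves to leaves, and the remaining
  vertices, equally many on both sides, to each other.\<close>

lemma bij_betw_extend:
  assumes "finite V" "N \<subseteq> V" "N' \<subseteq> V" "card N = card N'"
    "u \<in> V" "u' \<in> V" "u \<notin> N" "u' \<notin> N'"
  obtains \<phi> where "bij_betw \<phi> V V" "\<And>v. v \<in> V \<Longrightarrow> \<phi> v = u' \<longleftrightarrow> v = u"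
    "\<And>v. v \<in> V \<Longrightarrow> \<phi> v \<in> N' \<longleftrightarrow> v \<in> N"
proof -
  let ?R = "V - insert u N" and ?R' = "V - insert u' N'"
  have fin: "finite N" "finite N'" using assms finite_subset by blast+
  obtain \<psi> where \<psi>: "bij_betw \<psi> N N'"
    using fin assms(4) finite_same_card_bij by blast
  have "card ?R = card ?R'"
    using assms fin by (simp add: card_Diff_subset)
  then obtain \<rho> where \<rho>: "bij_betw \<rho> ?R ?R'"
    using assms(1) finite_same_card_bij[of ?R ?R'] by blast
  define \<phi> where "\<phi> v = (if v = u then u' else if v \<in> N then \<psi> v else \<rho> v)" for v
  have N: "bij_betw \<phi> N N'"
    using \<psi> by (rule bij_betw_cong[THEN iffD1, rotated]) (use assms in \<open>auto simp: \<phi>_def\<close>)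
  have R: "bij_betw \<phi> ?R ?R'"
    using \<rho> by (rule bij_betw_cong[THEN iffD1, rotated]) (auto simp: \<phi>_def)
  have U: "bij_betw \<phi> {u} {u'}" by (simp add: \<phi>_def bij_betw_def)
  have "bij_betw \<phi> ({u} \<union> N) ({u'} \<union> N')"
    using U N assms(8) by (intro bij_betw_combine) auto
  then have "bij_betw \<phi> (({u} \<union> N) \<union> ?R) (({u'} \<union> N') \<union> ?R')"
    using R by (rule bij_betw_combine) auto
  moreover have "({u} \<union> N) \<union> ?R = V" "({u'} \<union> N') \<union> ?R' = V" using assms by auto
  ultimately have bij: "bij_betw \<phi> V V" by simp
  show thesis
  proof (rule that[OF bij])
    fix v assume v: "v \<in> V"
    consider "v = u" | "v \<in> N" "v \<noteq> u" "\<phi> v \<in> N'" | "v \<in> ?R" "\<phi> v \<in> ?R'"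
      using v assms(7) N R by (metis DiffI bij_betwE insertE)
    then show "\<phi> v = u' \<longleftrightarrow> v = u" "\<phi> v \<in> N' \<longleftrightarrow> v \<in> N"
      using assms(7,8) by (cases; auto simp: \<phi>_def)+
  qed
qed

lemma star_isomorphic:
  assumes H: "H \<in> graphs n m" and G: "G \<in> graphs n m"
    and u: "u \<in> {1..n}" "\<forall>e\<in>H. u \<in> e" and u': "u' \<in> {1..n}" "\<forall>e\<in>G. u' \<in> e"
  shows "isomorphic n H G"
proof -
  \<comment> \<open>If all edges share \<open>c\<close>, the graph is determined by its leaf set
    \<open>N\<close>. With both graphs in this form, an isomorphism only has to respect centre and
    leaves.\<close>
  have nbrs: "\<exists>N \<subseteq> {1..n}. c \<notin> N \<and> card N = m \<and>
      (\<forall>x y. {x, y} \<in> K \<longleftrightarrow> x = c \<and> y \<in> N \<or> y = c \<and> x \<in> N)"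
    if K: "K \<in> graphs n m" and c: "\<forall>e\<in>K. c \<in> e" for K c
  proof (intro exI conjI)
    let ?N = "{v. {c, v} \<in> K}"
    show "?N \<subseteq> {1..n}" using graphsD(3)[OF K] by fastforce
    \<comment> \<open>\<open>{c, c}\<close> is a singleton, hence no edge. Thus the adjacency
      formula below is also right for \<open>x = y\<close>, a case that \<open>isomorphic\<close>
      includes.\<close>
    show "c \<notin> ?N" using graphsD(3)[OF K, of "{c, c}"] by auto
    have "K = (\<lambda>v. {c, v}) ` ?N"
    proof (intro equalityI subsetI)
      fix e assume e: "e \<in> K"
      obtain x y where "e = {x, y}"
        using graphsD(3)[OF K e] unfolding card_2_iff by metis
      moreover have "c \<in> e" using c e by simp
      ultimately have "e = {c, y} \<or> e = {c, x}" by (auto simp: insert_commute)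
      then obtain v where "e = {c, v}" by metis
      then show "e \<in> (\<lambda>v. {c, v}) ` ?N" using e by auto
    qed auto
    moreover have "inj_on (\<lambda>v. {c, v}) ?N" by (auto simp: inj_on_def doubleton_eq_iff)
    ultimately show "card ?N = m" using card_image graphsD(2)[OF K] by metis
    show "\<forall>x y. {x, y} \<in> K \<longleftrightarrow> x = c \<and> y \<in> ?N \<or> y = c \<and> x \<in> ?N"
    proof (intro allI)
      fix x y
      have "{x, y} \<in> K \<Longrightarrow> x = c \<or> y = c" using c by auto
      moreover have "{x, c} = {c, x}" by (rule insert_commute)
      ultimately show "{x, y} \<in> K \<longleftrightarrow> x = c \<and> y \<in> ?N \<or> y = c \<and> x \<in> ?N"
        by (metis mem_Collect_eq)
    qed
  qed
  from nbrs[OF H u(2)] obtain N where N: "N \<subseteq> {1..n}" "u \<notin> N" "card N = m"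
    "\<forall>x y. {x, y} \<in> H \<longleftrightarrow> x = u \<and> y \<in> N \<or> y = u \<and> x \<in> N"
    by (elim exE conjE)
  from nbrs[OF G u'(2)] obtain N' where N': "N' \<subseteq> {1..n}" "u' \<notin> N'" "card N' = m"
    "\<forall>x y. {x, y} \<in> G \<longleftrightarrow> x = u' \<and> y \<in> N' \<or> y = u' \<and> x \<in> N'"
    by (elim exE conjE)
  obtain \<phi> where "bij_betw \<phi> {1..n} {1..n}"
    "\<And>v. v \<in> {1..n} \<Longrightarrow> \<phi> v = u' \<longleftrightarrow> v = u" "\<And>v. v \<in> {1..n} \<Longrightarrow> \<phi> v \<in> N' \<longleftrightarrow> v \<in> N"
    using bij_betw_extend[of "{1..n}" N N' u u'] N N' u(1) u'(1) by auto
  then show ?thesis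
    unfolding isomorphic_def N(4)[rule_format] N'(4)[rule_format] by (intro exI[of _ \<phi>]) simp
qed

section \<open>Strictly convex edge weights\<close>

text \<open>Let \<open>a <= b\<close>. Moving \<open>b\<close> up to \<open>m\<close> gains more
  than moving \<open>a\<close> down to 1 loses: the distance \<open>m - b\<close> is at least
  \<open>a - 1\<close>, and by convexity the slopes beyond \<open>b\<close> exceed those below
  \<open>a\<close>.\<close>

lemma edge_weight_less:
  fixes g g' :: "real \<Rightarrow> real" and a b m :: real
  assumes der: "\<And>x. 1 \<le> x \<Longrightarrow> (g has_real_derivative g' x) (at x)"
    and pos: "\<And>x. 1 \<le> x \<Longrightarrow> 0 < g' x"
    and mono: "\<And>x y. 1 \<le> x \<Longrightarrow> x < y \<Longrightarrow> g' x < g' y"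
    and ab: "1 \<le> a" "1 \<le> b" "a + b \<le> m + 1" "a < m" "b < m"
  shows "g a + g b < g 1 + g m"
  using ab
proof (induction a b rule: linorder_wlog)
  case (le a b)
  obtain y where y: "b < y" "g m - g b = (m - b) * g' y"
    using MVT2[of b m g g'] der le by force
  show ?case
  \<comment> \<open>For \<open>a = 1\<close> there is no interval to the left for the mean value
    theorem; the gain from \<open>b < m\<close> alone is positive.\<close>
  proof (cases "a = 1")
    case True
    have "0 < (m - b) * g' y" using y pos[of y] le by simp
    then show ?thesis using True y by simp
  next
    case False
    then obtain x where x: "1 < x" "x < a" "g a - g 1 = (a - 1) * g' x"
      using MVT2[of 1 a g g'] der le by force
    have "(a - 1) * g' x < (a - 1) * g' y"
      using mono[of x y] x y le by simp
    also have "\<dots> \<le> (m - b) * g' y"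
      using le pos[of y] y by (intro mult_right_mono) auto
    finally show ?thesis using x y by simp
  qed
next
  case (sym a b)
  then show ?case by (simp add: add.commute)
qed

text \<open>Both families of functions are instances. The conditions on \<open>g'\<close> start at 1
  because every end of an edge has degree at least 1.\<close>

lemma uniquely_maximized_by_quasi_star:
  fixes f g g' :: "real \<Rightarrow> real"
  assumes fg: "\<And>k :: nat. f (real k) = real k * g (real k)"
    and der: "\<And>x. 1 \<le> x \<Longrightarrow> (g has_real_derivative g' x) (at x)"
    and pos: "\<And>x. 1 \<le> x \<Longrightarrow> 0 < g' x"
    and mono: "\<And>x y. 1 \<le> x \<Longrightarrow> x < y \<Longrightarrow> g' x < g' y"
    and "m < n"
  shows "uniquely_maximized_by f n m (quasi_star n m)"
proof -
  let ?S = "quasi_star n m" and ?M = "real m * (g 1 + g (real m))"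
  let ?w = "\<lambda>H e. \<Sum>v\<in>e. g (real (degree H v))"
  have S: "?S \<in> graphs n m" using quasi_star_in_graphs \<open>m < n\<close> .
  have S1: "\<forall>e\<in>?S. 1 \<in> e" by (auto simp: quasi_star_def)
  then have "degree ?S 1 = m"
    using degree_eq_card_iff graphsD[OF S] by metis
  then have "?w ?S e = g 1 + g (real m)" if "e \<in> ?S" for e
    using edge_weight_full_degree[OF S that, of 1 g] S1 that by blast
  then have SM: "Sigma_f f (degree_sequence n ?S) = ?M"
    using Sigma_f_eq_sum_edges[of ?S n m f g, OF S fg] graphsD(2)[OF S]
    by (simp cong: sum.cong)
  have strict: "?w H e < g 1 + g (real m)"
    if H: "H \<in> graphs n m" and e: "e \<in> H" and no: "\<forall>v\<in>e. degree H v \<noteq> m" for H e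
  proof -
    obtain u v where uv: "e = {u, v}" "u \<noteq> v"
      using graphsD(3)[OF H e] by (auto simp: card_2_iff)
    have ge: "1 \<le> degree H u" "1 \<le> degree H v"
      using degree_pos[OF graphsD(1)[OF H] e] uv by auto
    have le: "degree H u + degree H v \<le> m + 1"
      using degree_add_le[of H u v] graphsD[OF H] e uv by auto
    \<comment> \<open>Each degree is at most \<open>m\<close>, since the other is at least 1; by
      \<open>no\<close> it is less than \<open>m\<close>.\<close>
    have "g (real (degree H u)) + g (real (degree H v)) < g 1 + g (real m)"
      by (rule edge_weight_less[OF der pos mono]) (use ge le no uv in auto)
    then show ?thesis using uv by simp
  qed
  have weak: "?w H e \<le> g 1 + g (real m)" if H: "H \<in> graphs n m" and e: "e \<in> H" for H e
    using strict[OF that] edge_weight_full_degree[OF that, of _ g] by force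
  have "Sigma_f f (degree_sequence n H) \<le> ?M" if H: "H \<in> graphs n m" for H
    using sum_bounded_above[of H "?w H", OF weak[OF H]] Sigma_f_eq_sum_edges[of H n m f g, OF H fg]
      graphsD(2)[OF H] by simp
  moreover have "isomorphic n H ?S"
    if H: "H \<in> graphs n m" and eq: "Sigma_f f (degree_sequence n H) = ?M" for H
  proof -
    have "\<exists>u\<in>{1..n}. \<forall>e\<in>H. u \<in> e"
    \<comment> \<open>Without edges any vertex can serve as centre, and \<open>m < n\<close>
      provides one.\<close>
    proof (cases "H = {}")
      case True
      then show ?thesis using \<open>m < n\<close> by auto
    next
      case False
      \<comment> \<open>Otherwise every edge falls strictly short of the bound, and so does the sum
        over the nonempty \<open>H\<close>. A vertex of degree \<open>m = card H\<close> lies on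
        every edge.\<close>
      have "\<exists>e\<in>H. \<exists>u\<in>e. degree H u = m"
      proof (rule ccontr)
        assume "\<not> ?thesis"
        then have "sum (?w H) H < (\<Sum>e\<in>H. g 1 + g (real m))"
          using False graphsD(1)[OF H] strict[OF H] by (intro sum_strict_mono) auto
        then show False
          using eq Sigma_f_eq_sum_edges[of H n m f g, OF H fg] graphsD(2)[OF H] by simp
      qed
      then show ?thesis
        using degree_eq_card_iff graphsD[OF H] by (metis subsetD)
    qed
    then show ?thesis using star_isomorphic[OF H S, of _ 1] S1 \<open>m < n\<close> by auto
  qed
  ultimately show ?thesis
    using S SM by (auto simp: uniquely_maximized_by_def)
qed

text \<open>Gives the convexity of \<open>(exp (c * x) - 1) / x\<close>, with
  \<open>y = c * x\<close>. The right-hand side equals 2 at 0 and has derivative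
  \<open>exp y * y^2\<close>, positive away from 0.\<close>

lemma exp_quadratic_bound:
  fixes y :: real
  assumes "0 < y"
  shows "2 < exp y * (y\<^sup>2 - 2 * y + 2)"
proof -
  have "exp 0 * (0\<^sup>2 - 2 * 0 + 2) < exp y * (y\<^sup>2 - 2 * y + 2)"
  proof (rule DERIV_pos_imp_increasing_open[OF assms])
    fix x :: real assume x: "0 < x"
    have "((\<lambda>x. exp x * (x\<^sup>2 - 2 * x + 2)) has_real_derivative exp x * x\<^sup>2) (at x)"
      by (auto intro!: derivative_eq_intros simp: algebra_simps)
    then show "\<exists>d. ((\<lambda>x. exp x * (x\<^sup>2 - 2 * x + 2)) has_real_derivative d) (at x) \<and> 0 < d"
      using x by (intro exI[of _ "exp x * x\<^sup>2"]) simp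
  qed (intro continuous_intros)
  then show ?thesis by simp
qed

theorem corollary8:
  fixes f :: "real \<Rightarrow> real" and n m :: nat
  assumes "(\<exists>c>0. \<forall>x. f x = exp (c * x) - 1) \<or> (\<exists>\<beta>>2. \<forall>x\<ge>0. f x = x powr \<beta>)"
    and "m < n"
  shows "uniquely_maximized_by f n m (quasi_star n m)"
  using assms(1)
proof
  assume "\<exists>c>0. \<forall>x. f x = exp (c * x) - 1"
  then obtain c where c: "c > 0" "\<And>x. f x = exp (c * x) - 1" by blast
  let ?g = "\<lambda>x. (exp (c * x) - 1) / x"
  let ?g' = "\<lambda>x. (c * x * exp (c * x) - exp (c * x) + 1) / x\<^sup>2"
  \<comment> \<open>The derivative of \<open>?g'\<close>, arranged so that
    \<open>exp_quadratic_bound\<close> shows its numerator to be positive.\<close>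
  let ?g'' = "\<lambda>x. (exp (c * x) * ((c * x)\<^sup>2 - 2 * (c * x) + 2) - 2) / x ^ 3"
  show ?thesis
  proof (rule uniquely_maximized_by_quasi_star[where g = ?g and g' = ?g'])
    show "f (real k) = real k * ?g (real k)" for k by (simp add: c)
    show "(?g has_real_derivative ?g' x) (at x)" if "1 \<le> x" for x
      using that by (auto intro!: derivative_eq_intros simp: field_simps power2_eq_square)
    show "0 < ?g' x" if "1 \<le> x" for x
    proof -
      \<comment> \<open>Multiplying \<open>1 - t < exp (- t)\<close> by \<open>exp t\<close>, for
        \<open>t = c * x\<close>, makes the numerator of \<open>?g'\<close> positive.\<close>
      have "1 + - (c * x) < exp (- (c * x))"
        using exp_minus_greater[of "c * x"] that c by simp
      then have "(1 - c * x) * exp (c * x) < exp (- (c * x)) * exp (c * x)"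
        by simp
      then have "0 < c * x * exp (c * x) - exp (c * x) + 1"
        by (simp add: algebra_simps flip: exp_add)
      then show ?thesis using that by simp
    qed
    show "?g' x < ?g' y" if "1 \<le> x" "x < y" for x y
    proof (rule DERIV_pos_imp_increasing[OF that(2)])
      fix z assume "x \<le> z" "z \<le> y"
      then have z: "0 < z" using that by simp
      have "(?g' has_real_derivative ?g'' z) (at z)"
        using z by (auto intro!: derivative_eq_intros simp: field_simps power2_eq_square power3_eq_cube)
      moreover have "0 < ?g'' z"
        using exp_quadratic_bound[of "c * z"] z c by simp
      ultimately show "\<exists>d. (?g' has_real_derivative d) (at z) \<and> 0 < d" by blast
    qed
  qed fact
next
  assume "\<exists>\<beta>>2. \<forall>x\<ge>0. f x = x powr \<beta>"
  then obtain \<beta> where \<beta>: "\<beta> > 2" "\<And>x. x \<ge> 0 \<Longrightarrow> f x = x powr \<beta>" by blast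
  show ?thesis
  proof (rule uniquely_maximized_by_quasi_star[where g = "\<lambda>x. x powr (\<beta> - 1)"
        and g' = "\<lambda>x. (\<beta> - 1) * x powr (\<beta> - 2)"])
    show "f (real k) = real k * real k powr (\<beta> - 1)" for k
      by (cases "k = 0") (simp_all add: \<beta> powr_mult_base)
    show "((\<lambda>x. x powr (\<beta> - 1)) has_real_derivative (\<beta> - 1) * x powr (\<beta> - 2)) (at x)"
      if "1 \<le> x" for x
      using that by (auto intro!: derivative_eq_intros)
    show "0 < (\<beta> - 1) * x powr (\<beta> - 2)" if "1 \<le> x" for x
      using that \<beta> by simp
    \<comment> \<open>Here \<open>\<beta> > 2\<close> enters: the exponent is positive, so
      \<open>g'\<close> strictly increases. At exponent 2 it would be constant.\<close>
    show "(\<beta> - 1) * x powr (\<beta> - 2) < (\<beta> - 1) * y powr (\<beta> - 2)" if "1 \<le> x" "x < y" for x y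
      using that \<beta> by (simp add: powr_less_mono2)
  qed fact
qed

end
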